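(* Let $0.72\leq p\leq 1$, and for each $n$ let $G$ be the random spanning subgraph of $Q_n$ obtained by keeping each edge of $Q_n$ independently with probability $p$. Then $\lim_{n\to\infty}\Pr[\tilde G=Q_n]=1$.
   Context: $Q_n$ is the $n$-cube: the graph on $\{0,1\}^n$ in which $x,y$ are adjacent iff they differ in exactly one component. $\Omega_n$ is the set of spanning subgraphs of $Q_n$ (obtained by deleting edges only). For $G\in\Omega_n$, an embedding of $G$ is a permutation $\pi$ of $\{0,1\}^n$ such that $\pi(x)\pi(y)\in E(Q_n)$ for all $xy\in E(G)$. An edge $xy\in E(Q_n)$ is solid in $G$ if $\pi(x)\pi(y)\in E(Q_n)$ for every embedding $\pi$ of $G$. $\tilde G$ denotes the graph obtained from $G$ by adding all edges of $Q_n$ that are solid in $G$. *)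

theory Defs
  imports
    "HOL-Probability.Probability"
    "HOL-Probability.Product_PMF"
    "HOL-Combinatorics.Permutations"
begin

definition cube_verts :: "nat \<Rightarrow> bool list set" where
  "cube_verts n = {x. length x = n}"

definition cube_adj :: "nat \<Rightarrow> bool list \<Rightarrow> bool list \<Rightarrow> bool" where
  "cube_adj n x y \<longleftrightarrow> x \<in> cube_verts n \<and> y \<in> cube_verts n \<and>
     card {i. i < n \<and> x ! i \<noteq> y ! i} = 1"

definition cube_edges :: "nat \<Rightarrow> bool list set set" where
  "cube_edges n = {{x, y} | x y. cube_adj n x y}"

text \<open>All graphs below have vertex set \<^term>\<open>cube_verts n\<close>, so a spanning subgraph of
  the \<open>n\<close>-cube is identified with its edge set \<open>E \<subseteq> cube_edges n\<close>.\<close>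

definition embedding :: "nat \<Rightarrow> bool list set set \<Rightarrow> (bool list \<Rightarrow> bool list) \<Rightarrow> bool" where
  "embedding n E \<pi> \<longleftrightarrow> \<pi> permutes cube_verts n \<and>
     (\<forall>x y. {x, y} \<in> E \<longrightarrow> {\<pi> x, \<pi> y} \<in> cube_edges n)"

definition solid :: "nat \<Rightarrow> bool list set set \<Rightarrow> bool list set \<Rightarrow> bool" where
  "solid n E e \<longleftrightarrow> e \<in> cube_edges n \<and> (\<forall>\<pi>. embedding n E \<pi> \<longrightarrow> \<pi> ` e \<in> cube_edges n)"

definition solid_closure :: "nat \<Rightarrow> bool list set set \<Rightarrow> bool list set set" where
  "solid_closure n E = E \<union> {e. solid n E e}"

definition random_subgraph :: "nat \<Rightarrow> real \<Rightarrow> bool list set set pmf" where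
  "random_subgraph n p =
     map_pmf (\<lambda>keep. {e \<in> cube_edges n. keep e})
       (Pi_pmf (cube_edges n) False (\<lambda>_. bernoulli_pmf p))"

lemma finite_cube_verts: "finite (cube_verts n)"
  using finite_lists_length_eq[of "UNIV :: bool set" n] by (simp add: cube_verts_def)

lemma finite_cube_edges: "finite (cube_edges n)"
proof (rule finite_subset)
  show "cube_edges n \<subseteq> Pow (cube_verts n)"
    by (auto simp: cube_edges_def cube_adj_def)
  show "finite (Pow (cube_verts n))"
    by (simp add: finite_cube_verts)
qed

lemma set_random_subgraph: "set_pmf (random_subgraph n p) \<subseteq> Pow (cube_edges n)"
  by (auto simp: random_subgraph_def)

end

theory Submission
  imports Defs "HOL-Real_Asymp.Real_Asymp"
begin

text \<open>
  An edge of the cube in direction \<open>i\<close> lies on \<open>n - 1\<close> four-cycles, one for each other direction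
  \<open>j\<close>; the remaining three edges of such a cycle form a detour. If four detours consist of solid
  edges, then the edge is solid. Call an edge bad if at most three of its detours lie in \<open>E\<close>. If no
  two bad edges lie on a common four-cycle, every bad edge has only solid detours and is therefore
  solid too. For two given edges of a four-cycle and a further direction \<open>j\<close>, the two detours
  consist of at least five edges altogether, so both are broken with probability at most
  \<open>1 - 2 p\<^sup>3 + p\<^sup>5 \<le> 0.45\<close>, independently for different \<open>j\<close>. Since \<open>2 \<cdot> 0.45 < 1\<close>, a union bound
  over the pairs and their sets of exceptional directions, \<open>2\<^sup>n\<close> times polynomially many in total,
  finishes the proof.
\<close>

section \<open>Edges and four-cycles of the cube through coordinate flips\<close>

text \<open>An index out of range leaves the list alone, so \<open>flip_flip\<close> and
  \<open>flip_commute\<close> hold without side conditions.\<close>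

definition flip :: "bool list \<Rightarrow> nat \<Rightarrow> bool list" where
  "flip x i = x[i := \<not> x ! i]"

text \<open>An edge has two names, one from each end; \<open>edge_flip\<close>,
  \<open>detour_flip\<close> and \<open>bad_flip\<close> express independence of this
  choice.\<close>

definition edge :: "bool list \<Rightarrow> nat \<Rightarrow> bool list set" where
  "edge x i = {x, flip x i}"

text \<open>The last edge is named from the far end \<open>flip x i\<close>, which makes the
  symmetry between the two ends visible.\<close>

definition detour :: "bool list \<Rightarrow> nat \<Rightarrow> nat \<Rightarrow> bool list set set" where
  "detour x i j = {edge x j, edge (flip x j) i, edge (flip x i) j}"

lemma length_flip [simp]: "length (flip x i) = length x"
  by (simp add: flip_def)

lemma nth_flip: "j < length x \<Longrightarrow> flip x i ! j = (if i = j then \<not> x ! j else x ! j)"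
  by (auto simp: flip_def nth_list_update)

lemma flip_flip [simp]: "flip (flip x i) i = x"
  by (cases "i < length x") (auto simp: flip_def list_update_beyond)

lemma flip_commute: "flip (flip x i) j = flip (flip x j) i"
  by (cases "i = j") (auto simp: flip_def list_update_swap)

lemma flip_eq_iff [simp]:
  "i < length x \<Longrightarrow> j < length x \<Longrightarrow> flip x i = flip x j \<longleftrightarrow> i = j"
  by (metis nth_flip)

lemma flip_in_cube_verts [simp]: "flip x i \<in> cube_verts n \<longleftrightarrow> x \<in> cube_verts n"
  by (simp add: cube_verts_def)

lemma cube_adj_iff_flip:
  "cube_adj n x y \<longleftrightarrow> x \<in> cube_verts n \<and> (\<exists>i<n. y = flip x i)"
proof
  assume a: "cube_adj n x y"
  then obtain i where i: "{i. i < n \<and> x ! i \<noteq> y ! i} = {i}"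
    unfolding cube_adj_def using card_1_singletonE by blast
  then have "i < n" and diff: "\<And>m. m < n \<Longrightarrow> x ! m \<noteq> y ! m \<longleftrightarrow> m = i" by blast+
  have len: "length x = n" "length y = n" using a by (auto simp: cube_adj_def cube_verts_def)
  have "y = flip x i"
  proof (rule nth_equalityI)
    fix m assume "m < length y"
    then show "y ! m = flip x i ! m" using diff[of m] len by (auto simp: nth_flip)
  qed (simp add: len)
  then show "x \<in> cube_verts n \<and> (\<exists>i<n. y = flip x i)"
    using \<open>i < n\<close> len by (auto simp: cube_verts_def)
next
  assume "x \<in> cube_verts n \<and> (\<exists>i<n. y = flip x i)"
  then obtain i where i: "x \<in> cube_verts n" "i < n" "y = flip x i" by blast
  then have "{m. m < n \<and> x ! m \<noteq> y ! m} = {i}"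
    by (auto simp: cube_verts_def nth_flip split: if_splits)
  then show "cube_adj n x y"
    using i by (simp add: cube_adj_def)
qed

lemma cube_edges_eq: "cube_edges n = {edge x i | x i. x \<in> cube_verts n \<and> i < n}"
  unfolding cube_edges_def cube_adj_iff_flip edge_def by blast

lemma edge_in_cube_edges: "x \<in> cube_verts n \<Longrightarrow> i < n \<Longrightarrow> edge x i \<in> cube_edges n"
  by (auto simp: cube_edges_eq)

lemma cube_adj_commute: "cube_adj n x y \<longleftrightarrow> cube_adj n y x"
  by (auto simp: cube_adj_def eq_commute[of "x ! _"])

lemma pair_in_cube_edges_iff: "{x, y} \<in> cube_edges n \<longleftrightarrow> cube_adj n x y"
  using cube_adj_commute[of n x y] by (auto simp: cube_edges_def doubleton_eq_iff)

lemma edge_flip [simp]: "edge (flip x i) i = edge x i"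
  by (auto simp: edge_def)

lemma detour_flip: "detour (flip x i) i j = detour x i j"
  by (simp add: detour_def flip_commute[of x i j] insert_commute)

lemma detour_subset_cube_edges:
  "x \<in> cube_verts n \<Longrightarrow> i < n \<Longrightarrow> j < n \<Longrightarrow> detour x i j \<subseteq> cube_edges n"
  by (auto simp: detour_def intro!: edge_in_cube_edges)

text \<open>By parity, \<open>a\<close> and \<open>b\<close> are at distance 1 or 3; at distance 3, only three neighbours of
  \<open>a\<close> lie on a path of length 3 to \<open>b\<close>.\<close>

lemma adjacent_if_four_paths:
  assumes a: "a \<in> cube_verts n" and J: "card J \<ge> 4" and inj: "inj_on c J"
    and path: "\<And>j. j \<in> J \<Longrightarrow> cube_adj n a (c j) \<and> cube_adj n (c j) (d j) \<and> cube_adj n (d j) b"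
  shows "cube_adj n a b"
proof (rule ccontr)
  assume na: "\<not> cube_adj n a b"
  define D where "D = {m. m < n \<and> a ! m \<noteq> b ! m}"
  have step: "\<exists>s\<in>D. c j = flip a s \<and> card D = 3" if j: "j \<in> J" for j
  proof -
    obtain s t r where str: "s < n" "t < n" "r < n"
      "c j = flip a s" "d j = flip (c j) t" "b = flip (d j) r"
      using path[OF j] by (auto simp: cube_adj_iff_flip)
    then have b: "b = flip (flip (flip a s) t) r" by simp
    have nb: "b \<noteq> flip a k" if "k < n" for k
      using na a that by (auto simp: cube_adj_iff_flip)
    \<comment> \<open>If two of the three directions agree, those two flips cancel and
      \<open>b\<close> becomes a neighbour of \<open>a\<close>.\<close>
    have "s \<noteq> t" using nb[OF str(3)] b by auto
    have "t \<noteq> r" using nb[OF str(1)] b by auto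
    have "s \<noteq> r" using nb[OF str(2)] b by (auto simp: flip_commute[of a s t])
    then have "D = {s, t, r}"
      using a str b \<open>s \<noteq> t\<close> \<open>t \<noteq> r\<close> by (auto simp: D_def cube_verts_def nth_flip split: if_splits)
    then show ?thesis
      using str \<open>s \<noteq> t\<close> \<open>t \<noteq> r\<close> \<open>s \<noteq> r\<close> by auto
  qed
  then obtain s where s: "\<And>j. j \<in> J \<Longrightarrow> s j \<in> D \<and> c j = flip a (s j) \<and> card D = 3"
    by metis
  \<comment> \<open>The second vertices \<open>c j\<close> are distinct, so the first directions are
    distinct too: at least four of them inside a set of size three.\<close>
  have "inj_on s J"
    using inj s by (metis (no_types, lifting) inj_on_def)
  moreover have "s ` J \<subseteq> D" using s by auto
  moreover have "finite D" by (simp add: D_def)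
  ultimately have "card J \<le> card D" by (metis card_inj_on_le)
  moreover have "J \<noteq> {}" using J by auto
  then have "card D = 3" using s by blast
  ultimately show False using J by simp
qed

section \<open>Solid edges, bad edges and the deterministic criterion\<close>

text \<open>An embedding turns the detours into walks of length three between the images of the
  ends, and being a permutation it keeps their second vertices distinct. Detours need only be solid,
  not contained in \<open>E\<close>, so the criterion can be applied a second time to the bad
  edges.\<close>

lemma solid_if_four_detours:
  assumes x: "x \<in> cube_verts n" and i: "i < n"
    and J: "card {j. j < n \<and> j \<noteq> i \<and> (\<forall>e\<in>detour x i j. solid n E e)} \<ge> 4"
  shows "solid n E (edge x i)"
  unfolding solid_def
proof (intro conjI allI impI)
  show "edge x i \<in> cube_edges n" by (rule edge_in_cube_edges[OF x i])
  fix \<pi> assume \<pi>: "embedding n E \<pi>"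
  let ?J = "{j. j < n \<and> j \<noteq> i \<and> (\<forall>e\<in>detour x i j. solid n E e)}"
  have perm: "\<pi> permutes cube_verts n" using \<pi> by (simp add: embedding_def)
  have adj: "cube_adj n (\<pi> u) (\<pi> (flip u k))" if "solid n E (edge u k)" for u k
    using that \<pi> by (simp add: solid_def edge_def flip: pair_in_cube_edges_iff)
  have "cube_adj n (\<pi> x) (\<pi> (flip x i))"
  proof (rule adjacent_if_four_paths[where J = ?J and c = "\<lambda>j. \<pi> (flip x j)"
        and d = "\<lambda>j. \<pi> (flip (flip x j) i)"])
    show "\<pi> x \<in> cube_verts n" using perm x by (simp add: permutes_in_image)
    show "card ?J \<ge> 4" by (rule J)
    show "inj_on (\<lambda>j. \<pi> (flip x j)) ?J"
      using x by (auto simp: inj_on_def cube_verts_def dest!: injD[OF permutes_inj[OF perm]])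
    fix j assume "j \<in> ?J"
    then show "cube_adj n (\<pi> x) (\<pi> (flip x j)) \<and>
      cube_adj n (\<pi> (flip x j)) (\<pi> (flip (flip x j) i)) \<and>
      cube_adj n (\<pi> (flip (flip x j) i)) (\<pi> (flip x i))"
      using adj[of x j] adj[of "flip x j" i] adj[of "flip x i" j]
      by (simp add: detour_def flip_commute[of x i j] cube_adj_commute[of n "\<pi> (flip x i)"])
  qed
  then show "\<pi> ` edge x i \<in> cube_edges n"
    by (simp add: edge_def pair_in_cube_edges_iff)
qed

text \<open>Badness counts detours inside \<open>E\<close> rather than solid ones: this makes it an
  event about finitely many specified random edges.\<close>

definition bad :: "nat \<Rightarrow> bool list set set \<Rightarrow> bool list \<Rightarrow> nat \<Rightarrow> bool" where
  "bad n E x i \<longleftrightarrow> card {j. j < n \<and> j \<noteq> i \<and> detour x i j \<subseteq> E} \<le> 3"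

lemma bad_flip: "bad n E (flip x i) i \<longleftrightarrow> bad n E x i"
  by (simp add: bad_def detour_flip)

lemma solid_if_mem:
  assumes "e \<in> E" "E \<subseteq> cube_edges n"
  shows "solid n E e"
proof -
  obtain x y where "e = {x, y}" using assms by (auto simp: cube_edges_def)
  then show ?thesis using assms by (auto simp: solid_def embedding_def)
qed

lemma solid_if_not_bad:
  assumes "E \<subseteq> cube_edges n" "x \<in> cube_verts n" "i < n" "\<not> bad n E x i"
  shows "solid n E (edge x i)"
proof (rule solid_if_four_detours)
  have "card {j. j < n \<and> j \<noteq> i \<and> detour x i j \<subseteq> E}
      \<le> card {j. j < n \<and> j \<noteq> i \<and> (\<forall>e\<in>detour x i j. solid n E e)}"
    using assms(1) by (intro card_mono) (auto intro: solid_if_mem)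
  then show "4 \<le> card {j. j < n \<and> j \<noteq> i \<and> (\<forall>e\<in>detour x i j. solid n E e)}"
    using assms(4) by (simp add: bad_def)
qed (rule assms)+

text \<open>The last two hypotheses are the two positions of distinct edges on a common four-cycle:
  meeting at a vertex, or parallel. The bound on \<open>n\<close> leaves a bad edge its
  \<open>n - 1 \<ge> 4\<close> detours.\<close>

lemma solid_closure_eq_cube_edges:
  assumes E: "E \<subseteq> cube_edges n" and n: "n \<ge> 5"
    and adjacent: "\<And>x i k. x \<in> cube_verts n \<Longrightarrow> i < n \<Longrightarrow> k < n \<Longrightarrow> i \<noteq> k \<Longrightarrow>
      \<not> (bad n E x i \<and> bad n E x k)"
    and opposite: "\<And>x i k. x \<in> cube_verts n \<Longrightarrow> i < n \<Longrightarrow> k < n \<Longrightarrow> i \<noteq> k \<Longrightarrow>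
      \<not> (bad n E x i \<and> bad n E (flip x k) i)"
  shows "solid_closure n E = cube_edges n"
proof -
  have "solid n E (edge x i)" if x: "x \<in> cube_verts n" and i: "i < n" for x i
  proof (cases "bad n E x i")
    case True
    have *: "\<not> bad n E x j" "\<not> bad n E (flip x i) j" "\<not> bad n E (flip x j) i"
      if j: "j < n" "i \<noteq> j" for j
    proof -
      show "\<not> bad n E x j" using adjacent[OF x i j] True by blast
      \<comment> \<open>The bad edge is renamed from its other end, so that \<open>adjacent\<close>
        also covers the edges meeting it there.\<close>
      have "flip x i \<in> cube_verts n" "bad n E (flip x i) i"
        using x True by (simp_all add: bad_flip)
      then show "\<not> bad n E (flip x i) j" using adjacent[OF _ i j] by blast
      show "\<not> bad n E (flip x j) i" using opposite[OF x i j] True by blast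
    qed
    have "\<forall>e\<in>detour x i j. solid n E e" if j: "j < n" "i \<noteq> j" for j
    proof -
      have "solid n E (edge x j)" "solid n E (edge (flip x j) i)" "solid n E (edge (flip x i) j)"
        using *[OF j] j x i by (simp_all add: solid_if_not_bad[OF E])
      then show ?thesis by (simp add: detour_def)
    qed
    then have "{j. j < n \<and> j \<noteq> i \<and> (\<forall>e\<in>detour x i j. solid n E e)} = {..<n} - {i}"
      by auto
    then show ?thesis
      using i n by (intro solid_if_four_detours[OF x i]) simp
  next
    case False
    then show ?thesis by (rule solid_if_not_bad[OF E x i])
  qed
  then show ?thesis
    using E unfolding solid_closure_def by (auto simp: cube_edges_eq solid_def)
qed

section \<open>Independence and product bounds for finite product distributions\<close>

lemma prob_pair_pmf_times:
  "measure_pmf.prob (pair_pmf M N) (A \<times> B) = measure_pmf.prob M A * measure_pmf.prob N B"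
proof -
  \<comment> \<open>Cutting down to the supports makes both factors countable, as
    \<open>measure_pmf_prob_product\<close> requires.\<close>
  have "measure_pmf.prob (pair_pmf M N) (A \<times> B)
      = measure_pmf.prob (pair_pmf M N) ((A \<inter> set_pmf M) \<times> (B \<inter> set_pmf N))"
    by (subst measure_Int_set_pmf[symmetric]) (simp add: Times_Int_Times)
  also have "\<dots> = measure_pmf.prob M A * measure_pmf.prob N B"
    by (subst measure_pmf_prob_product) (auto simp: measure_Int_set_pmf)
  finally show ?thesis .
qed

text \<open>The hypotheses let \<open>P\<close> depend on the coordinates in \<open>A\<close> only
  and \<open>Q\<close> on those in \<open>U - A\<close> only. Splitting the product along
  \<open>A\<close> turns the joint event into a rectangle.\<close>

lemma prob_Pi_pmf_conj:
  assumes fin: "finite U" and A: "A \<subseteq> U"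
    and P: "\<And>f g. (\<And>e. e \<in> A \<Longrightarrow> f e = g e) \<Longrightarrow> P f = P g"
    and Q: "\<And>f g. (\<And>e. e \<in> U - A \<Longrightarrow> f e = g e) \<Longrightarrow> Q f = Q g"
  shows "measure_pmf.prob (Pi_pmf U d p) {f. P f \<and> Q f}
    = measure_pmf.prob (Pi_pmf U d p) {f. P f} * measure_pmf.prob (Pi_pmf U d p) {f. Q f}"
proof -
  let ?MA = "Pi_pmf A d p" and ?MB = "Pi_pmf (U - A) d p"
  let ?h = "\<lambda>(f, g) e. if e \<in> A then f e else g e"
  have finA: "finite A" using A fin finite_subset by blast
  have U: "Pi_pmf U d p = map_pmf ?h (pair_pmf ?MA ?MB)"
    using Pi_pmf_union[of A "U - A" d p] finA fin A by (simp add: Un_absorb1)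
  have hP: "P (?h (f, g)) = P f" for f g by (rule P) auto
  have hQ: "Q (?h (f, g)) = Q g" for f g by (rule Q) auto
  have "?h -` {f. P f \<and> Q f} = {f. P f} \<times> {g. Q g}"
    "?h -` {f. P f} = {f. P f} \<times> UNIV" "?h -` {f. Q f} = UNIV \<times> {g. Q g}"
    using hP hQ by auto
  then show ?thesis
    by (simp add: U prob_pair_pmf_times)
qed

text \<open>One block is peeled off at a time: by disjointness the remaining events see only
  coordinates outside \<open>F j\<close>, so \<open>prob_Pi_pmf_conj\<close> applies.\<close>

lemma prob_Pi_pmf_blocks_le:
  assumes fin: "finite U" and J: "finite J" and F: "\<And>j. j \<in> J \<Longrightarrow> F j \<subseteq> U"
    and disj: "\<And>j k. j \<in> J \<Longrightarrow> k \<in> J \<Longrightarrow> j \<noteq> k \<Longrightarrow> F j \<inter> F k = {}"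
    and P: "\<And>j f g. j \<in> J \<Longrightarrow> (\<And>e. e \<in> F j \<Longrightarrow> f e = g e) \<Longrightarrow> P j f = P j g"
    and q: "\<And>j. j \<in> J \<Longrightarrow> measure_pmf.prob (Pi_pmf U d p) {f. P j f} \<le> q"
  shows "measure_pmf.prob (Pi_pmf U d p) {f. \<forall>j\<in>J. P j f} \<le> q ^ card J"
  using J F disj P q
proof (induction J rule: finite_induct)
  case (insert j J)
  have "measure_pmf.prob (Pi_pmf U d p) {f. \<forall>k\<in>insert j J. P k f}
      = measure_pmf.prob (Pi_pmf U d p) {f. P j f \<and> (\<forall>k\<in>J. P k f)}"
    by simp
  also have "\<dots> = measure_pmf.prob (Pi_pmf U d p) {f. P j f}
      * measure_pmf.prob (Pi_pmf U d p) {f. \<forall>k\<in>J. P k f}"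
  proof (rule prob_Pi_pmf_conj[OF fin, of "F j"])
    show "F j \<subseteq> U" using insert.prems(1) by simp
    show "P j f = P j g" if "\<And>e. e \<in> F j \<Longrightarrow> f e = g e" for f g
      using insert.prems(3)[of j f g] that by simp
    show "(\<forall>k\<in>J. P k f) = (\<forall>k\<in>J. P k g)" if fg: "\<And>e. e \<in> U - F j \<Longrightarrow> f e = g e" for f g
    proof (rule ball_cong[OF refl])
      fix k assume k: "k \<in> J"
      then have "F k \<subseteq> U - F j"
        using insert.prems(1)[of k] insert.prems(2)[of k j] insert.hyps(2) by auto
      then show "P k f = P k g"
        using insert.prems(3)[of k f g] fg k by blast
    qed
  qed
  also have "\<dots> \<le> q * q ^ card J"
  proof (rule mult_mono)
    show q1: "measure_pmf.prob (Pi_pmf U d p) {f. P j f} \<le> q"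
      using insert.prems(4) by simp
    show "measure_pmf.prob (Pi_pmf U d p) {f. \<forall>k\<in>J. P k f} \<le> q ^ card J"
    proof (rule insert.IH)
      show "F k \<subseteq> U" if "k \<in> J" for k using insert.prems(1) that by simp
      show "F k \<inter> F l = {}" if "k \<in> J" "l \<in> J" "k \<noteq> l" for k l
        using insert.prems(2) that by simp
      show "P k f = P k g" if "k \<in> J" "\<And>e. e \<in> F k \<Longrightarrow> f e = g e" for k f g
        by (rule insert.prems(3)) (use that in auto)
      show "measure_pmf.prob (Pi_pmf U d p) {f. P k f} \<le> q" if "k \<in> J" for k
        using insert.prems(4) that by simp
    qed
    show "0 \<le> q" by (rule order_trans[OF measure_nonneg q1])
  qed simp
  finally show ?case using insert.hyps by simp
qed simp

lemma prob_Pi_pmf_bernoulli_all: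
  assumes "finite U" "S \<subseteq> U" "0 \<le> p" "p \<le> 1"
  shows "measure_pmf.prob (Pi_pmf U d (\<lambda>_. bernoulli_pmf p)) {f. \<forall>e\<in>S. f e} = p ^ card S"
proof -
  have "measure_pmf.prob (Pi_pmf U d (\<lambda>_. bernoulli_pmf p)) {f. \<forall>e\<in>S. f e}
      = measure_pmf.prob (Pi_pmf U d (\<lambda>_. bernoulli_pmf p))
          (Pi U (\<lambda>e. if e \<in> S then {True} else UNIV))"
    using assms(2) by (intro arg_cong[where f = "measure_pmf.prob _"]) (auto simp: Pi_def)
  also have "\<dots> = (\<Prod>e\<in>U. if e \<in> S then p else 1)"
    using assms by (subst measure_Pi_pmf_Pi) (auto intro!: prod.cong simp: measure_pmf_single)
  also have "\<dots> = p ^ card S"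
    using assms by (simp add: prod.If_cases Int_absorb1)
  finally show ?thesis .
qed

text \<open>Inclusion-exclusion for the complementary events: a triple is complete with probability
  \<open>p ^ 3\<close>, and both are with probability \<open>p ^ card (S1 \<union> S2)\<close>,
  which is at most \<open>p ^ 5\<close> because \<open>p \<le> 1\<close>.\<close>

lemma prob_two_triples_missing_le:
  fixes p :: real
  assumes fin: "finite U" and S: "S1 \<subseteq> U" "S2 \<subseteq> U" "card S1 = 3" "card S2 = 3"
    and un: "5 \<le> card (S1 \<union> S2)" and p: "0 \<le> p" "p \<le> 1"
  shows "measure_pmf.prob (Pi_pmf U d (\<lambda>_. bernoulli_pmf p))
    {f. \<not> (\<forall>e\<in>S1. f e) \<and> \<not> (\<forall>e\<in>S2. f e)} \<le> 1 - 2 * p ^ 3 + p ^ 5"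
proof -
  let ?M = "Pi_pmf U d (\<lambda>_. bernoulli_pmf p)"
  let ?A = "{f. \<forall>e\<in>S1. f e}" and ?B = "{f. \<forall>e\<in>S2. f e}"
  note all = prob_Pi_pmf_bernoulli_all[OF fin _ p]
  have "?A \<inter> ?B = {f. \<forall>e\<in>S1 \<union> S2. f e}" by auto
  then have "measure_pmf.prob ?M (?A \<inter> ?B) = p ^ card (S1 \<union> S2)"
    using all[of "S1 \<union> S2"] S by auto
  also have "\<dots> \<le> p ^ 5" using un p by (intro power_decreasing)
  finally have AB: "measure_pmf.prob ?M (?A \<inter> ?B) \<le> p ^ 5" .
  have "measure_pmf.prob ?M (?A \<union> ?B)
      = measure_pmf.prob ?M ?A + measure_pmf.prob ?M ?B - measure_pmf.prob ?M (?A \<inter> ?B)"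
    by (rule measure_Un3) (simp_all add: measure_pmf.fmeasurable_eq_sets)
  moreover have "measure_pmf.prob ?M {f. \<not> (\<forall>e\<in>S1. f e) \<and> \<not> (\<forall>e\<in>S2. f e)}
      = 1 - measure_pmf.prob ?M (?A \<union> ?B)"
    by (subst measure_pmf.prob_compl[symmetric])
      (auto intro!: arg_cong[where f = "measure_pmf.prob ?M"])
  ultimately show ?thesis using AB all[of S1] all[of S2] S by simp
qed

text \<open>The derivative \<open>- t^2 * (6 - 5 * t^2)\<close> is nonpositive up to 1, so the worst
  case is 0.72, with value about 0.447. A value below 1/2 is needed to beat the \<open>2 ^ n\<close>
  vertices.\<close>

lemma rate_bound:
  fixes p :: real
  assumes "0.72 \<le> p" "p \<le> 1"
  shows "1 - 2 * p ^ 3 + p ^ 5 \<le> 0.45"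
proof -
  define h where "h t = 1 - 2 * t ^ 3 + t ^ 5" for t :: real
  have "h p \<le> h 0.72"
  proof (rule DERIV_nonpos_imp_nonincreasing[OF assms(1)])
    fix t :: real assume t: "0.72 \<le> t" "t \<le> p"
    have "(h has_real_derivative - (t\<^sup>2 * (6 - 5 * t\<^sup>2))) (at t)"
      unfolding h_def by (auto intro!: derivative_eq_intros
          simp: algebra_simps power2_eq_square power_numeral_reduce)
    moreover have "t\<^sup>2 \<le> 1" using t assms by (simp add: power_le_one)
    ultimately show "\<exists>y. (h has_real_derivative y) (at t) \<and> y \<le> 0"
      by (intro exI conjI) auto
  qed
  then show ?thesis by (simp add: h_def power_numeral_reduce)
qed

section \<open>Sizes and disjointness of detours\<close>

lemma edge_eq_iff:
  "edge x i = edge y j \<longleftrightarrow> (x = y \<and> flip x i = flip y j) \<or> (x = flip y j \<and> flip x i = y)"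
  by (simp add: edge_def doubleton_eq_iff)

lemma edge_eq_imp:
  assumes eq: "edge x i = edge y j" and i: "i < length x"
  shows "i = j \<and> (y = x \<or> y = flip x i)"
proof (cases "x = y")
  case True
  then have "flip x i = flip x j" using eq unfolding edge_eq_iff by metis
  then have "flip x i ! i = flip x j ! i" by simp
  then show ?thesis using True i by (simp add: nth_flip split: if_splits)
next
  case False
  then have yj: "x = flip y j" and xi: "flip x i = y" using eq unfolding edge_eq_iff by blast+
  \<comment> \<open>Flipping \<open>i\<close> and then \<open>j\<close> restores coordinate
    \<open>i\<close> only if the directions agree.\<close>
  have "flip (flip x i) j = x" unfolding xi by (rule yj[symmetric])
  then have "flip (flip x i) j ! i = x ! i" by (rule arg_cong)
  then have "i = j" using i by (simp add: nth_flip split: if_splits)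
  then show ?thesis using xi[symmetric] by blast
qed

text \<open>For parallel edges the separating coordinate must differ from \<open>i\<close>, since
  \<open>x\<close> and \<open>flip x i\<close> name the same edge.\<close>

lemma edge_neq:
  assumes "i < length x" "i = j \<longrightarrow> (\<exists>m<length x. m \<noteq> i \<and> x ! m \<noteq> y ! m)"
  shows "edge x i \<noteq> edge y j"
  using edge_eq_imp[of x i y j] assms by (auto simp: nth_flip)

lemma card_detour:
  assumes "i < length x" "j < length x" "i \<noteq> j"
  shows "card (detour x i j) = 3"
proof -
  have "edge x j \<noteq> edge (flip x j) i" "edge (flip x j) i \<noteq> edge (flip x i) j"
    using assms by (intro edge_neq; simp)+
  moreover have "edge x j \<noteq> edge (flip x i) j"
    using assms by (intro edge_neq) (auto simp: nth_flip intro!: exI[of _ i])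
  ultimately show ?thesis by (simp add: detour_def)
qed

text \<open>The detours share their first edge \<open>edge x j\<close> and no other, which leaves 3
  + 3 - 1 edges.\<close>

lemma card_adjacent_detours:
  assumes "i < length x" "j < length x" "k < length x" "i \<noteq> j" "k \<noteq> j" "i \<noteq> k"
  shows "5 \<le> card (detour x i j \<union> detour x k j)"
proof -
  let ?L = "[edge x j, edge (flip x j) i, edge (flip x j) k, edge (flip x i) j, edge (flip x k) j]"
  have "edge x j \<noteq> edge (flip x i) j" "edge (flip x i) j \<noteq> edge (flip x k) j"
    using assms by (intro edge_neq; auto simp: nth_flip intro!: exI[of _ i])+
  moreover have "edge x j \<noteq> edge (flip x k) j"
    using assms by (intro edge_neq; auto simp: nth_flip intro!: exI[of _ k])+
  moreover have "edge x j \<noteq> edge (flip x j) i" "edge x j \<noteq> edge (flip x j) k"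
    "edge (flip x j) i \<noteq> edge (flip x j) k"
    "edge (flip x j) i \<noteq> edge (flip x i) j" "edge (flip x j) i \<noteq> edge (flip x k) j"
    "edge (flip x j) k \<noteq> edge (flip x i) j" "edge (flip x j) k \<noteq> edge (flip x k) j"
    using assms by (intro edge_neq; simp)+
  ultimately have "distinct ?L" by simp
  then have "card (set ?L) = 5" using distinct_card by fastforce
  moreover have "set ?L \<subseteq> detour x i j \<union> detour x k j" by (auto simp: detour_def)
  ultimately show ?thesis by (metis card_mono detour_def finite.emptyI finite.insertI finite_UnI)
qed

lemma detour_unchanged:
  assumes "e \<in> detour x i j" "v \<in> e" "m < length x" "m \<noteq> i" "m \<noteq> j"
  shows "v ! m = x ! m"
  using assms by (auto simp: detour_def edge_def nth_flip)

text \<open>The only edge of the four-cycle with both ends on the side of \<open>x\<close> in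
  direction \<open>j\<close> is \<open>edge x i\<close>, which the detour omits.\<close>

lemma detour_changed:
  assumes "e \<in> detour x i j" "j < length x" "i \<noteq> j"
  shows "\<exists>v\<in>e. v ! j \<noteq> x ! j"
  using assms by (auto simp: detour_def edge_def nth_flip)

text \<open>Coordinate \<open>j\<close> separates them: each edge of the first detour has an end
  where it is flipped, while the second detour moves only in directions \<open>i'\<close> and
  \<open>j'\<close> and keeps the common value.\<close>

lemma detours_disjoint:
  assumes "length x = length y" "j < length x" "i \<noteq> j" "i' \<noteq> j" "j \<noteq> j'" "x ! j = y ! j"
  shows "detour x i j \<inter> detour y i' j' = {}"
proof -
  have False if e: "e \<in> detour x i j" "e \<in> detour y i' j'" for e
  proof -
    obtain v where "v \<in> e" "v ! j \<noteq> x ! j" using detour_changed[OF e(1)] assms by blast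
    then show False using detour_unchanged[OF e(2), of v j] assms by simp
  qed
  then show ?thesis by blast
qed

text \<open>Coordinate \<open>k\<close> is constant on each detour, with opposite values, so all six
  edges are distinct; five is stated to match the adjacent case.\<close>

lemma card_opposite_detours:
  assumes "i < length x" "j < length x" "k < length x" "i \<noteq> j" "k \<noteq> j" "i \<noteq> k"
  shows "5 \<le> card (detour x i j \<union> detour (flip x k) i j)"
proof -
  have "detour x i j \<inter> detour (flip x k) i j = {}"
  proof (rule ccontr)
    assume "detour x i j \<inter> detour (flip x k) i j \<noteq> {}"
    then obtain e where e: "e \<in> detour x i j" "e \<in> detour (flip x k) i j" by blast
    then obtain v where "v \<in> e" by (auto simp: detour_def edge_def)
    then show False
      using detour_unchanged[OF e(1), of v k] detour_unchanged[OF e(2), of v k] assms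
      by (auto simp: nth_flip)
  qed
  then have "card (detour x i j \<union> detour (flip x k) i j) = 3 + 3"
    using assms by (subst card_Un_disjoint) (auto simp: card_detour, auto simp: detour_def)
  then show ?thesis by simp
qed

section \<open>Probability estimates, union bounds and the limit\<close>

text \<open>The pair \<open>(y, l)\<close> names the second edge, so that one estimate serves both
  adjacent and opposite edges. Outside a set of exceptional directions all detours of both edges are
  broken, and the directions form independent blocks.\<close>

lemma prob_bad_pair_le:
  fixes p :: real
  assumes n: "n \<ge> 8" and x: "x \<in> cube_verts n" and i: "i < n" and k: "k < n" and ik: "i \<noteq> k"
    and y: "(y, l) = (x, k) \<or> (y, l) = (flip x k, i)" and p: "0.72 \<le> p" "p \<le> 1"
  shows "measure_pmf.prob (random_subgraph n p) {E. bad n E x i \<and> bad n E y l}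
    \<le> real n ^ 8 * 0.45 ^ (n - 8)"
proof -
  let ?U = "cube_edges n"
  let ?M = "Pi_pmf ?U False (\<lambda>_. bernoulli_pmf p)"
  \<comment> \<open>Eight is 2 + 3 + 3: the directions \<open>i\<close> and \<open>k\<close>, and at
    most three unbroken detours for each bad edge.\<close>
  define \<T> where "\<T> = {T. T \<subseteq> {..<n} \<and> card T = 8 \<and> {i, k} \<subseteq> T}"
  define P where "P j f \<longleftrightarrow> \<not> (\<forall>e\<in>detour x i j. f e) \<and> \<not> (\<forall>e\<in>detour y l j. f e)"
    for j and f :: "bool list set \<Rightarrow> bool"
  have lx: "length x = n" using x by (simp add: cube_verts_def)
  have yv: "y \<in> cube_verts n" and ly: "length y = n" and l: "l < n" "l = i \<or> l = k"
    using y x i k lx by auto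
  \<comment> \<open>Agreement of the base points at \<open>j\<close> is what
    \<open>detours_disjoint\<close> needs to separate blocks across the two edges.\<close>
  have yx: "y ! j = x ! j" if "j < n" "j \<noteq> k" for j
    using y that lx by (auto simp: nth_flip)
  have finT: "finite \<T>" by (auto simp: \<T>_def intro!: finite_subset[of _ "Pow {..<n}"])
  have "\<T> \<subseteq> {T. T \<subseteq> {..<n} \<and> card T = 8}" by (auto simp: \<T>_def)
  then have "card \<T> \<le> n choose 8"
    using card_mono[of "{T. T \<subseteq> {..<n} \<and> card T = 8}" \<T>] by (simp add: n_subsets)
  then have cardT: "card \<T> \<le> n ^ 8" using binomial_le_pow[OF n] by linarith

  have block: "measure_pmf.prob ?M {f. \<forall>j\<in>{..<n} - T. P j f} \<le> 0.45 ^ (n - 8)"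
    if T: "T \<in> \<T>" for T
  proof -
    have J: "j < n" "j \<noteq> i" "j \<noteq> k" "j \<noteq> l" if "j \<in> {..<n} - T" for j
      using that T l by (auto simp: \<T>_def)
    have sub: "detour x i j \<subseteq> ?U" "detour y l j \<subseteq> ?U" if "j < n" for j
      using detour_subset_cube_edges x i yv l that by auto
    have "measure_pmf.prob ?M {f. \<forall>j\<in>{..<n} - T. P j f} \<le> 0.45 ^ card ({..<n} - T)"
    proof (rule prob_Pi_pmf_blocks_le[where F = "\<lambda>j. detour x i j \<union> detour y l j"])
      show "finite ?U" by (rule finite_cube_edges)
      show "finite ({..<n} - T)" by simp
    next
      fix j assume j: "j \<in> {..<n} - T"
      show "detour x i j \<union> detour y l j \<subseteq> ?U" using sub J[OF j] by simp
      have un: "5 \<le> card (detour x i j \<union> detour y l j)"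
        using y card_adjacent_detours[of i x j k] card_opposite_detours[of i x j k] J[OF j] i k ik lx
        by auto
      have "measure_pmf.prob ?M {f. P j f} \<le> 1 - 2 * p ^ 3 + p ^ 5"
        unfolding P_def
      proof (rule prob_two_triples_missing_le[OF finite_cube_edges _ _ _ _ un])
        show "card (detour x i j) = 3" "card (detour y l j) = 3"
          using card_detour J[OF j] i l lx ly by auto
      qed (use sub J[OF j] p in auto)
      then show "measure_pmf.prob ?M {f. P j f} \<le> 0.45" using rate_bound[OF p] by linarith
    next
      fix j j' assume j: "j \<in> {..<n} - T" and j': "j' \<in> {..<n} - T" and "j \<noteq> j'"
      then show "(detour x i j \<union> detour y l j) \<inter> (detour x i j' \<union> detour y l j') = {}"
        using detours_disjoint[of x x j i i j'] detours_disjoint[of x y j i l j']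
          detours_disjoint[of y x j l i j'] detours_disjoint[of y y j l l j'] J[OF j] lx ly yx[of j]
        by (simp add: Int_Un_distrib Int_Un_distrib2)
    next
      fix j and f g :: "bool list set \<Rightarrow> bool"
      assume "\<And>e. e \<in> detour x i j \<union> detour y l j \<Longrightarrow> f e = g e"
      then show "P j f = P j g" unfolding P_def by auto
    qed
    also have "card ({..<n} - T) = n - 8"
      using T card_Diff_subset[of T "{..<n}"] finite_subset[of T "{..<n}"] by (simp add: \<T>_def)
    finally show ?thesis .
  qed

  have "measure_pmf.prob (random_subgraph n p) {E. bad n E x i \<and> bad n E y l}
      = measure_pmf.prob ?M {f. bad n {e \<in> ?U. f e} x i \<and> bad n {e \<in> ?U. f e} y l}"
    by (simp add: random_subgraph_def vimage_def)
  also have "\<dots> \<le> measure_pmf.prob ?M (\<Union>T\<in>\<T>. {f. \<forall>j\<in>{..<n} - T. P j f})"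
  proof (rule measure_pmf.finite_measure_mono)
    show "{f. bad n {e \<in> ?U. f e} x i \<and> bad n {e \<in> ?U. f e} y l}
        \<subseteq> (\<Union>T\<in>\<T>. {f. \<forall>j\<in>{..<n} - T. P j f})"
    proof
      fix f assume "f \<in> {f. bad n {e \<in> ?U. f e} x i \<and> bad n {e \<in> ?U. f e} y l}"
      define E where "E = {e \<in> ?U. f e}"
      define G where "G u m = {j. j < n \<and> j \<noteq> m \<and> detour u m j \<subseteq> E}" for u m
      have "card (G x i) \<le> 3" "card (G y l) \<le> 3"
        using \<open>f \<in> _\<close> by (auto simp: G_def E_def bad_def)
      then have "card ({i, k} \<union> (G x i \<union> G y l)) \<le> 8"
        using card_Un_le[of "{i, k}" "G x i \<union> G y l"] card_Un_le[of "G x i" "G y l"] ik by simp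
      moreover have "{i, k} \<union> (G x i \<union> G y l) \<subseteq> {..<n}" using i k by (auto simp: G_def)
      \<comment> \<open>Padding to exactly eight directions, possible since
        \<open>n \<ge> 8\<close>, leaves the same number \<open>n - 8\<close> of blocks for every
        \<open>T\<close>.\<close>
      ultimately obtain T where T: "{i, k} \<union> (G x i \<union> G y l) \<subseteq> T" "T \<subseteq> {..<n}" "card T = 8"
        using exists_subset_between[of "{i, k} \<union> (G x i \<union> G y l)" 8 "{..<n}"] n by auto
      have "P j f" if j: "j \<in> {..<n} - T" for j
      proof -
        have "j < n" "j \<noteq> i" "j \<noteq> l" "j \<notin> G x i" "j \<notin> G y l" using j T l by auto
        then have "\<not> detour x i j \<subseteq> E" "\<not> detour y l j \<subseteq> E" by (auto simp: G_def)
        moreover have "detour x i j \<subseteq> ?U" "detour y l j \<subseteq> ?U"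
          using detour_subset_cube_edges x i yv l \<open>j < n\<close> by auto
        ultimately show ?thesis unfolding P_def E_def by blast
      qed
      then show "f \<in> (\<Union>T\<in>\<T>. {f. \<forall>j\<in>{..<n} - T. P j f})"
        using T by (auto simp: \<T>_def)
    qed
  qed simp
  also have "\<dots> \<le> (\<Sum>T\<in>\<T>. measure_pmf.prob ?M {f. \<forall>j\<in>{..<n} - T. P j f})"
    by (rule measure_pmf.finite_measure_subadditive_finite) (auto simp: finT)
  also have "\<dots> \<le> real (card \<T>) * 0.45 ^ (n - 8)"
    by (rule sum_bounded_above) (rule block)
  also have "\<dots> \<le> real n ^ 8 * 0.45 ^ (n - 8)"
    using cardT by (intro mult_right_mono) (simp_all flip: of_nat_power)
  finally show ?thesis .
qed

text \<open>There are at most \<open>2 ^ n * n^2\<close> triples of a vertex and two directions,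
  each costing \<open>n^8 * 0.45 ^ (n - 8)\<close>; the factor 2 accounts for adjacent and opposite
  pairs. Naming a pair of edges several times is harmless in a union bound.\<close>

lemma prob_not_rigid_le:
  fixes p :: real
  assumes n: "n \<ge> 8" and p: "0.72 \<le> p" "p \<le> 1"
  shows "measure_pmf.prob (random_subgraph n p) {E. solid_closure n E \<noteq> cube_edges n}
    \<le> 2 * (2 ^ n * real n ^ 10 * 0.45 ^ (n - 8))"
proof -
  let ?R = "random_subgraph n p"
  define I where "I = {(x, i, k). x \<in> cube_verts n \<and> i < n \<and> k < n \<and> i \<noteq> k}"
  define A where "A = (\<lambda>(x, i, k). {E. bad n E x i \<and> bad n E x k})"
  define B where "B = (\<lambda>(x, i, k). {E. bad n E x i \<and> bad n E (flip x k) i})"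
  let ?q = "real n ^ 8 * 0.45 ^ (n - 8) :: real"
  have I: "I \<subseteq> cube_verts n \<times> {..<n} \<times> {..<n}" by (auto simp: I_def)
  then have finI: "finite I" by (rule finite_subset) (simp add: finite_cube_verts)
  have "card (cube_verts n) = 2 ^ n"
    using card_lists_length_eq[of "UNIV :: bool set" n] by (simp add: cube_verts_def)
  then have "card I \<le> 2 ^ n * (n * n)"
    using card_mono[OF _ I] by (simp add: finite_cube_verts card_cartesian_product)
  then have "real (card I) \<le> real (2 ^ n * (n * n))" by (rule of_nat_mono)
  then have cardI: "real (card I) \<le> 2 ^ n * real n ^ 2" by (simp add: power2_eq_square)
  have A: "measure_pmf.prob ?R (A t) \<le> ?q" and B: "measure_pmf.prob ?R (B t) \<le> ?q"
    if t: "t \<in> I" for t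
  proof -
    obtain x i k where t: "t = (x, i, k)" and "x \<in> cube_verts n" "i < n" "k < n" "i \<noteq> k"
      using t by (auto simp: I_def)
    then show "measure_pmf.prob ?R (A t) \<le> ?q" "measure_pmf.prob ?R (B t) \<le> ?q"
      unfolding A_def B_def t prod.case
      by (intro prob_bad_pair_le[OF n _ _ _ _ _ p, where k = k]; simp)+
  qed
  have bound: "measure_pmf.prob ?R (\<Union>t\<in>I. C t) \<le> 2 ^ n * real n ^ 10 * 0.45 ^ (n - 8)"
    if C: "\<And>t. t \<in> I \<Longrightarrow> measure_pmf.prob ?R (C t) \<le> ?q" for C
  proof -
    have "measure_pmf.prob ?R (\<Union>t\<in>I. C t) \<le> (\<Sum>t\<in>I. measure_pmf.prob ?R (C t))"
      by (rule measure_pmf.finite_measure_subadditive_finite) (auto simp: finI)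
    also have "\<dots> \<le> real (card I) * ?q" by (rule sum_bounded_above) (rule C)
    also have "\<dots> \<le> (2 ^ n * real n ^ 2) * ?q" by (rule mult_right_mono[OF cardI]) simp
    also have "\<dots> = 2 ^ n * real n ^ 10 * 0.45 ^ (n - 8)" by (simp flip: power_add)
    finally show ?thesis .
  qed
  \<comment> \<open>Passing to the support supplies \<open>E \<subseteq> cube_edges n\<close> for
    the deterministic criterion.\<close>
  have "measure_pmf.prob ?R {E. solid_closure n E \<noteq> cube_edges n}
      = measure_pmf.prob ?R ({E. solid_closure n E \<noteq> cube_edges n} \<inter> set_pmf ?R)"
    by (rule measure_Int_set_pmf[symmetric])
  also have "\<dots> \<le> measure_pmf.prob ?R ((\<Union>t\<in>I. A t) \<union> (\<Union>t\<in>I. B t))"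
  proof (rule measure_pmf.finite_measure_mono)
    show "{E. solid_closure n E \<noteq> cube_edges n} \<inter> set_pmf ?R \<subseteq> (\<Union>t\<in>I. A t) \<union> (\<Union>t\<in>I. B t)"
    proof (rule subsetI, rule ccontr)
      fix E assume E: "E \<in> {E. solid_closure n E \<noteq> cube_edges n} \<inter> set_pmf ?R"
        and "E \<notin> (\<Union>t\<in>I. A t) \<union> (\<Union>t\<in>I. B t)"
      then have "\<not> (bad n E x i \<and> bad n E x k)" "\<not> (bad n E x i \<and> bad n E (flip x k) i)"
        if "x \<in> cube_verts n" "i < n" "k < n" "i \<noteq> k" for x i k
        using that unfolding I_def A_def B_def by blast+
      moreover have "E \<subseteq> cube_edges n" using E set_random_subgraph by blast
      ultimately have "solid_closure n E = cube_edges n"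
        using n by (intro solid_closure_eq_cube_edges) auto
      then show False using E by simp
    qed
  qed simp
  also have "\<dots> \<le> measure_pmf.prob ?R (\<Union>t\<in>I. A t) + measure_pmf.prob ?R (\<Union>t\<in>I. B t)"
    by (rule measure_Un_le) simp_all
  also have "\<dots> \<le> 2 ^ n * real n ^ 10 * 0.45 ^ (n - 8) + 2 ^ n * real n ^ 10 * 0.45 ^ (n - 8)"
    by (rule add_mono[OF bound[OF A] bound[OF B]])
  finally show ?thesis by simp
qed

theorem theorem6:
  fixes p :: real
  assumes "0.72 \<le> p" and "p \<le> 1"
  shows "(\<lambda>n. measure_pmf.prob (random_subgraph n p)
           {E. solid_closure n E = cube_edges n}) \<longlonglongrightarrow> 1"
proof -
  define r where "r n = 2 * (2 ^ n * real n ^ 10 * 0.45 ^ (n - 8) :: real)" for n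
  define F where "F n = measure_pmf.prob (random_subgraph n p)
    {E. solid_closure n E \<noteq> cube_edges n}" for n
  \<comment> \<open>Here 0.9 is 2 * 0.45, and the constant absorbs the shift in
    \<open>n - 8\<close>; the two forms agree once \<open>n \<ge> 8\<close>, where the subtraction
    is not truncated.\<close>
  have "(\<lambda>n. 2 * 0.45 powr (-8) * (real n ^ 10 * 0.9 ^ n) :: real) \<longlonglongrightarrow> 0"
    by real_asymp
  moreover have "\<forall>\<^sub>F n in sequentially. 2 * 0.45 powr (-8) * (real n ^ 10 * 0.9 ^ n) = r n"
    using eventually_ge_at_top[of 8]
  proof eventually_elim
    case (elim n)
    have "(0.9::real) ^ n = 2 ^ n * 0.45 ^ (8 + (n - 8))"
      using elim by (simp flip: power_mult_distrib)
    then show ?case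
      by (simp add: r_def power_add powr_minus field_simps)
  qed
  ultimately have "r \<longlonglongrightarrow> 0" by (rule Lim_transform_eventually)
  moreover have "\<forall>\<^sub>F n in sequentially. 0 \<le> F n" by (simp add: F_def)
  moreover have "\<forall>\<^sub>F n in sequentially. F n \<le> r n"
    using eventually_ge_at_top[of 8]
    by eventually_elim (simp add: F_def r_def prob_not_rigid_le[OF _ assms, simplified])
  ultimately have "F \<longlonglongrightarrow> 0"
    using tendsto_sandwich[OF _ _ tendsto_const, of 0 F sequentially r] by blast
  then have "(\<lambda>n. 1 - F n) \<longlonglongrightarrow> 1 - 0" by (intro tendsto_diff tendsto_const)
  moreover have "measure_pmf.prob (random_subgraph n p) {E. solid_closure n E = cube_edges n}
      = 1 - F n" for n
    unfolding F_def by (subst measure_pmf.prob_compl[symmetric])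
      (auto intro!: arg_cong[where f = "measure_pmf.prob _"])
  ultimately show ?thesis by simp
qed

end
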